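(* Consider the problem in $\mathbb{R}^4$: minimize $f_0(x)=x^TA_0x=2x_1x_2-2x_2x_3+x_3^2-2x_1x_4$ subject to $f_1(x)=x^TA_1x-1=x_1^2+x_2^2+x_3^2+x_4^2-1=0$ and $f_2(x)=x^TA_2x-1=2x_2x_3+2x_1x_4+x_1^2+x_2^2+x_3^2+x_4^2-1\le 0$, where $A_0,A_1,A_2$ are the symmetric matrices of these quadratic forms. Then: (a) the Slater condition holds (there is $\tilde x\in\mathbb{R}^4$ with $f_1(\tilde x)=0$ and $f_2(\tilde x)<0$), and there exist $\mu_0,\mu_1,\mu_2\in\mathbb{R}$ with $\mu_0A_0+\mu_1A_1+\mu_2A_2\succ 0$; (b) the point $x^*=[0,0,0,1]^T$ and the multipliers $(\mu_1^*,\mu_2^* )=(-1,1)$ satisfy $f_1(x^* )=0=f_2(x^* )$, $(A_0+\mu_1^*A_1+\mu_2^*A_2)x^*=0$, and $v^T(A_0+\mu_1^*A_1+\mu_2^*A_2)v\ge 0$ for all $v\in\mathbb{R}^4$ with $v^TA_1x^*=0=v^TA_2x^*$; (c) the nonzero vector $\bar v=[0,1,0,0]^T$ satisfies $\bar v^TA_1x^*=0=\bar v^TA_2x^*$ and $\bar v^T(A_0+\mu_1^*A_1+\mu_2^*A_2)\bar v=0=\bar v^T(A_2-A_1)\bar v$; (d) nevertheless, $x^*$ is not a local minimizer of the problem.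
   Context: For a matrix $M$, $M\succ 0$ means that $M$ is symmetric positive definite. A local minimizer is a feasible point whose objective value is at most that of every feasible point in some neighborhood. *)

theory Defs
  imports "HOL-Analysis.Analysis"
begin

definition pos_def :: "real ^ 'n ^ 'n \<Rightarrow> bool"
  where "pos_def M \<longleftrightarrow> transpose M = M \<and> (\<forall>x. x \<noteq> 0 \<longrightarrow> x \<bullet> (M *v x) > 0)"

definition local_minimizer :: "('a::topological_space \<Rightarrow> real) \<Rightarrow> 'a set \<Rightarrow> 'a \<Rightarrow> bool"
  where "local_minimizer f S x \<longleftrightarrow>
    x \<in> S \<and> (\<exists>U. open U \<and> x \<in> U \<and> (\<forall>y \<in> S \<inter> U. f x \<le> f y))"

text \<open>In the index type \<open>4\<close> the numeral \<open>4\<close> equals \<open>0\<close>; the four indices are \<open>1, 2, 3, 4\<close>.\<close>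

definition f0 :: "real ^ 4 \<Rightarrow> real"
  where "f0 x = 2 * x$1 * x$2 - 2 * x$2 * x$3 + (x$3)^2 - 2 * x$1 * x$4"

definition f1 :: "real ^ 4 \<Rightarrow> real"
  where "f1 x = (x$1)^2 + (x$2)^2 + (x$3)^2 + (x$4)^2 - 1"

definition f2 :: "real ^ 4 \<Rightarrow> real"
  where "f2 x = 2 * x$2 * x$3 + 2 * x$1 * x$4 + (x$1)^2 + (x$2)^2 + (x$3)^2 + (x$4)^2 - 1"

definition feasible_set :: "(real ^ 4) set"
  where "feasible_set = {x. f1 x = 0 \<and> f2 x \<le> 0}"

definition A0 :: "real ^ 4 ^ 4"
  where "A0 = vector [vector [0,  1,  0, -1],
                      vector [1,  0, -1,  0],
                      vector [0, -1,  1,  0],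
                      vector [-1, 0,  0,  0]]"

definition A1 :: "real ^ 4 ^ 4"
  where "A1 = vector [vector [1, 0, 0, 0],
                      vector [0, 1, 0, 0],
                      vector [0, 0, 1, 0],
                      vector [0, 0, 0, 1]]"

definition A2 :: "real ^ 4 ^ 4"
  where "A2 = vector [vector [1, 0, 0, 1],
                      vector [0, 1, 1, 0],
                      vector [0, 1, 1, 0],
                      vector [1, 0, 0, 1]]"

lemma vec4_nth:
  "(vector [a, b, c, d] :: 'a::zero ^ 4) $ 1 = a"
  "(vector [a, b, c, d] :: 'a::zero ^ 4) $ 2 = b"
  "(vector [a, b, c, d] :: 'a::zero ^ 4) $ 3 = c"
  "(vector [a, b, c, d] :: 'a::zero ^ 4) $ 4 = d"
  unfolding vector_def by simp_all

lemma transpose_A: "transpose A0 = A0" "transpose A1 = A1" "transpose A2 = A2"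
  unfolding vec_eq_iff forall_4 transpose_def A0_def A1_def A2_def
  by (simp_all only: vec4_nth vec_lambda_beta simp_thms)

lemma quadratic_form_A:
  "f0 x = x \<bullet> (A0 *v x)"
  "f1 x = x \<bullet> (A1 *v x) - 1"
  "f2 x = x \<bullet> (A2 *v x) - 1"
  unfolding f0_def f1_def f2_def A0_def A1_def A2_def inner_vec_def
      matrix_vector_mult_def sum_4
  by (simp_all only: vec4_nth vec_lambda_beta inner_real_def) algebra+

end

theory Submission
  imports Defs
begin

text \<open>
  The pencil \<open>A0 - A1 + A2\<close> has the quadratic form \<open>2 x1 x2 + x3^2\<close>, while the tangent space at
  \<open>x* = (0, 0, 0, 1)\<close> of the two constraints is \<open>x1 = x4 = 0\<close>, where that form is \<open>x3^2\<close>. It is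
  nonnegative there, but it is degenerate in the direction of \<open>x2\<close>, so along a curve leaving \<open>x*\<close>
  in this direction terms of higher order decide.

  On the unit sphere, \<open>f2 \<le> 0\<close> says \<open>x2 x3 + x1 x4 \<le> 0\<close>. Where equality holds, the objective is
  \<open>2 x1 x2 + x3^2\<close>, and for \<open>x2 = t\<close>, \<open>x4 = 1\<close> equality means \<open>x1 = - t x3\<close>. The objective becomes
  \<open>x3^2 - 2 t^2 x3\<close>, which \<open>x3 = t^2\<close> minimizes with the value \<open>- t^4\<close>. All forms involved are
  homogeneous, so dividing \<open>(-t^3, t, t^2, 1)\<close> by its norm gives, for \<open>t \<noteq> 0\<close>, feasible points with
  \<open>f0 < 0 = f0 x*\<close>; they tend to \<open>x*\<close> as \<open>t\<close> tends to \<open>0\<close>. The other claims are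
  computations with the quadratic forms.
\<close>

definition descent_curve :: "real \<Rightarrow> real ^ 4"
  where "descent_curve t =
    (1 / sqrt (t^6 + t^2 + t^4 + 1)) *\<^sub>R vector [- (t^3), t, t^2, 1]"

lemma descent_curve_values:
  "f1 (descent_curve t) = 0"
  "f2 (descent_curve t) = 0"
  "f0 (descent_curve t) = - (t^4) / (t^6 + t^2 + t^4 + 1)"
proof -
  define q where "q = t^6 + t^2 + t^4 + 1"
  define s where "s = 1 / sqrt q"
  have q: "q > 0" unfolding q_def by (simp add: add_nonneg_pos)
  have s2: "s^2 = 1 / q" using q by (simp add: s_def power_divide)
  have sq: "s^2 * (t^6 + t^2 + t^4 + 1) = 1" using s2 q by (simp flip: q_def)
  have nth: "descent_curve t $ 1 = - (s * t^3)" "descent_curve t $ 2 = s * t"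
    "descent_curve t $ 3 = s * t^2" "descent_curve t $ 4 = s"
    by (simp_all add: descent_curve_def vec4_nth s_def q_def)
  have "f1 (descent_curve t) = s^2 * (t^6 + t^2 + t^4 + 1) - 1"
    unfolding f1_def nth by algebra
  then show f1: "f1 (descent_curve t) = 0" by (simp only: sq)
  have "f2 (descent_curve t) = f1 (descent_curve t)"
    unfolding f1_def f2_def nth by algebra
  then show "f2 (descent_curve t) = 0" by (simp only: f1)
  have "f0 (descent_curve t) = - (s^2 * t^4)"
    unfolding f0_def nth by algebra
  then show "f0 (descent_curve t) = - (t^4) / (t^6 + t^2 + t^4 + 1)"
    by (simp add: s2 q_def)
qed

lemma descent_curve_tendsto: "(descent_curve \<longlongrightarrow> vector [0, 0, 0, 1]) (at 0)"
proof -
  have "((\<lambda>t. vector [- (t^3), t, t^2, 1] :: real ^ 4) \<longlongrightarrow> vector [0, 0, 0, 1]) (at 0)"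
  proof (rule vec_tendstoI)
    fix i :: 4
    have "\<forall>i. ((\<lambda>t. (vector [- (t^3), t, t^2, 1] :: real ^ 4) $ i)
        \<longlongrightarrow> (vector [0, 0, 0, 1] :: real ^ 4) $ i) (at 0)"
      unfolding forall_4 vec4_nth by (auto intro!: tendsto_eq_intros)
    then show "((\<lambda>t. (vector [- (t^3), t, t^2, 1] :: real ^ 4) $ i)
        \<longlongrightarrow> (vector [0, 0, 0, 1] :: real ^ 4) $ i) (at 0)" ..
  qed
  moreover have "((\<lambda>t::real. 1 / sqrt (t^6 + t^2 + t^4 + 1)) \<longlongrightarrow> 1) (at 0)"
    by (auto intro!: tendsto_eq_intros)
  ultimately have "((\<lambda>t. (1 / sqrt (t^6 + t^2 + t^4 + 1)) *\<^sub>R (vector [- (t^3), t, t^2, 1] :: real ^ 4))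
      \<longlongrightarrow> 1 *\<^sub>R vector [0, 0, 0, 1]) (at 0)"
    by (intro tendsto_scaleR)
  then show ?thesis
    unfolding descent_curve_def by (simp only: scaleR_one)
qed

lemma not_local_minimizer_via_limit:
  assumes "(g \<longlongrightarrow> x) F" and "F \<noteq> bot" and "\<forall>\<^sub>F t in F. g t \<in> S \<and> f (g t) < f x"
  shows "\<not> local_minimizer f S x"
proof
  assume "local_minimizer f S x"
  then obtain U where U: "open U" "x \<in> U" "\<forall>y \<in> S \<inter> U. f x \<le> f y"
    unfolding local_minimizer_def by blast
  have "\<forall>\<^sub>F t in F. g t \<in> U" using assms(1) U(1,2) by (rule topological_tendstoD)
  with assms(3) have "\<forall>\<^sub>F t in F. False"
    by eventually_elim (use U(3) in force)
  with assms(2) show False by simp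
qed

lemma not_local_minimizer_e4: "\<not> local_minimizer f0 feasible_set (vector [0, 0, 0, 1])"
proof (rule not_local_minimizer_via_limit [OF descent_curve_tendsto])
  have "descent_curve t \<in> feasible_set \<and> f0 (descent_curve t) < f0 (vector [0, 0, 0, 1])"
    if "t \<noteq> 0" for t
    using that
    by (simp add: feasible_set_def descent_curve_values f0_def [of "vector _"] vec4_nth
        add_nonneg_pos)
  then show "\<forall>\<^sub>F t in at 0. descent_curve t \<in> feasible_set
      \<and> f0 (descent_curve t) < f0 (vector [0, 0, 0, 1])"
    by (simp add: eventually_at_filter)
qed simp

text \<open>
  The absolute row sums of \<open>A0\<close> are at most \<open>2\<close>, so adding \<open>3\<close> times the identity makes it strictly
  diagonally dominant; completing squares shows the definiteness.
\<close>

lemma pos_def_A0_plus_3_A1: "pos_def (A0 + 3 *\<^sub>R A1)"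
  unfolding pos_def_def
proof (intro conjI allI impI)
  have "transpose (A0 + 3 *\<^sub>R A1) = transpose A0 + 3 *\<^sub>R transpose A1"
    by (simp add: transpose_def vec_eq_iff)
  then show "transpose (A0 + 3 *\<^sub>R A1) = A0 + 3 *\<^sub>R A1" by (simp only: transpose_A)
next
  fix x :: "real ^ 4"
  assume "x \<noteq> 0"
  have "x \<bullet> ((A0 + 3 *\<^sub>R A1) *v x) = f0 x + 3 * (f1 x + 1)"
    by (simp add: quadratic_form_A matrix_vector_mult_add_rdistrib inner_add_right
        flip: scaleR_matrix_vector_assoc)
  also have "\<dots> = (x$1 + x$2)^2 + (x$2 - x$3)^2 + (x$1 - x$4)^2
      + (x$1)^2 + (x$2)^2 + 3 * (x$3)^2 + 2 * (x$4)^2"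
    unfolding f0_def f1_def by algebra
  also have "\<dots> > 0"
  proof -
    have "x$1 \<noteq> 0 \<or> x$2 \<noteq> 0 \<or> x$3 \<noteq> 0 \<or> x$4 \<noteq> 0"
      using \<open>x \<noteq> 0\<close> by (simp add: vec_eq_iff forall_4)
    then have "(x$1)^2 > 0 \<or> (x$2)^2 > 0 \<or> (x$3)^2 > 0 \<or> (x$4)^2 > 0"
      by simp
    moreover have "(x$1 + x$2)^2 \<ge> 0" "(x$2 - x$3)^2 \<ge> 0" "(x$1 - x$4)^2 \<ge> 0"
      "(x$1)^2 \<ge> 0" "(x$2)^2 \<ge> 0" "(x$3)^2 \<ge> 0" "(x$4)^2 \<ge> 0"
      by simp_all
    ultimately show ?thesis by linarith
  qed
  finally show "x \<bullet> ((A0 + 3 *\<^sub>R A1) *v x) > 0" .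
qed

theorem mainTheorem6:
  fixes xstar vbar :: "real ^ 4" and \<mu>1_star \<mu>2_star :: real
  assumes "xstar = vector [0, 0, 0, 1]"
    and "vbar = vector [0, 1, 0, 0]"
    and "\<mu>1_star = -1"
    and "\<mu>2_star = 1"
  shows
    "((\<exists>xtilde. f1 xtilde = 0 \<and> f2 xtilde < 0) \<and>
      (\<exists>\<mu>0 \<mu>1 \<mu>2. pos_def (\<mu>0 *\<^sub>R A0 + \<mu>1 *\<^sub>R A1 + \<mu>2 *\<^sub>R A2)))
     \<and>
     (f1 xstar = 0 \<and> f2 xstar = 0 \<and>
      (A0 + \<mu>1_star *\<^sub>R A1 + \<mu>2_star *\<^sub>R A2) *v xstar = 0 \<and>
      (\<forall>v. v \<bullet> (A1 *v xstar) = 0 \<and> v \<bullet> (A2 *v xstar) = 0 \<longrightarrow>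
           v \<bullet> ((A0 + \<mu>1_star *\<^sub>R A1 + \<mu>2_star *\<^sub>R A2) *v v) \<ge> 0))
     \<and>
     (vbar \<noteq> 0 \<and>
      vbar \<bullet> (A1 *v xstar) = 0 \<and> vbar \<bullet> (A2 *v xstar) = 0 \<and>
      vbar \<bullet> ((A0 + \<mu>1_star *\<^sub>R A1 + \<mu>2_star *\<^sub>R A2) *v vbar) = 0 \<and>
      vbar \<bullet> ((A2 - A1) *v vbar) = 0)
     \<and>
     \<not> local_minimizer f0 feasible_set xstar"
proof -
  have xs: "xstar $ 1 = 0" "xstar $ 2 = 0" "xstar $ 3 = 0" "xstar $ 4 = 1"
    unfolding assms vec4_nth by simp_all
  have vb: "vbar $ 1 = 0" "vbar $ 2 = 1" "vbar $ 3 = 0" "vbar $ 4 = 0"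
    unfolding assms vec4_nth by simp_all
  let ?M = "A0 + \<mu>1_star *\<^sub>R A1 + \<mu>2_star *\<^sub>R A2"
  have form_M: "v \<bullet> (?M *v v) = 2 * v$1 * v$2 + (v$3)^2" for v
  proof -
    have "v \<bullet> (?M *v v) = f0 v - (f1 v + 1) + (f2 v + 1)"
      by (simp add: quadratic_form_A assms matrix_vector_mult_add_rdistrib
          matrix_vector_mult_diff_rdistrib inner_diff_right inner_add_right)
    then show ?thesis unfolding f0_def f1_def f2_def by algebra
  qed
  have slater: "\<exists>xtilde. f1 xtilde = 0 \<and> f2 xtilde < 0"
    by (rule exI [of _ "vector [3/5, 0, 0, -4/5]"])
      (simp add: f1_def f2_def vec4_nth power2_eq_square)
  have definite: "\<exists>\<mu>0 \<mu>1 \<mu>2. pos_def (\<mu>0 *\<^sub>R A0 + \<mu>1 *\<^sub>R A1 + \<mu>2 *\<^sub>R A2)"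
    by (rule exI [of _ 1], rule exI [of _ 3], rule exI [of _ 0])
      (simp add: pos_def_A0_plus_3_A1)
  have active: "f1 xstar = 0" "f2 xstar = 0"
    by (simp_all add: f1_def f2_def xs)
  have stationary: "?M *v xstar = 0"
    unfolding vec_eq_iff forall_4 matrix_vector_mult_def sum_4 A0_def A1_def A2_def
    by (simp add: vec4_nth xs assms(3,4))
  have A1x: "v \<bullet> (A1 *v xstar) = v$4" and A2x: "v \<bullet> (A2 *v xstar) = v$1 + v$4" for v
    unfolding inner_vec_def matrix_vector_mult_def sum_4 A1_def A2_def
    by (simp_all add: vec4_nth xs)
  have second_order: "v \<bullet> (?M *v v) \<ge> 0"
    if "v \<bullet> (A1 *v xstar) = 0 \<and> v \<bullet> (A2 *v xstar) = 0" for v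
  proof -
    have "v$1 = 0" using that unfolding A1x A2x by linarith
    then show ?thesis unfolding form_M by simp
  qed
  have "vbar \<noteq> 0" using vb(2) by auto
  moreover have "vbar \<bullet> ((A2 - A1) *v vbar) = 0"
  proof -
    have "vbar \<bullet> ((A2 - A1) *v vbar) = f2 vbar - f1 vbar"
      by (simp add: quadratic_form_A matrix_vector_mult_diff_rdistrib inner_diff_right)
    then show ?thesis by (simp add: f1_def f2_def vb)
  qed
  moreover have "\<not> local_minimizer f0 feasible_set xstar"
    unfolding assms(1) by (rule not_local_minimizer_e4)
  ultimately show ?thesis
    using slater definite active stationary second_order
    by (simp add: A1x A2x form_M vb)
qed

end
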